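(* Let $G$ be a connected simple graph on $n \ge 2$ vertices with vertex set $V(G)=\{1,\dots,n\}$, and let $\lambda_1$ be the largest eigenvalue of its adjacency matrix. For $k\ge 0$ define $$\gamma^{(k)}=\sqrt{\frac{\sum_{i\in V(G)} d_{k+1}^2(i)}{\sum_{i\in V(G)} d_k^2(i)}},$$ and let $\phi(x)=e^{x}+(n-1)-x$. Then the sequence $\{\phi(\gamma^{(k)})\}_{k\ge 0}$ is increasing (i.e. $\phi(\gamma^{(k)})\le\phi(\gamma^{(k+1)})$ for all $k$) and converges to $\phi(\lambda_1)$. Moreover, for all $k\ge 0$, $$EE(G) > e^{\gamma^{(k)}}+n-1-\gamma^{(k)}.$$
   Context: For a vertex $i$, $d_k(i)$ denotes the number of walks of length $k$ in $G$ starting at $i$; thus $d_0(i)=1$, $d_1(i)$ is the degree of $i$, and $d_{k+1}(i)=\sum_{j\text{ adjacent to } i} d_k(j)$. In particular $\gamma^{(0)}=\sqrt{\sum_i d_1(i)^2/n}$. The Estrada index of $G$ is $EE(G)=\sum_{i=1}^n e^{\lambda_i}$, where $\lambda_1\ge\dots\ge\lambda_n$ are the eigenvalues of the adjacency matrix of $G$. *)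

theory Defs
  imports
    "Graph_Theory.Arc_Walk"
    "Graph_Theory.Digraph_Component"
    "Jordan_Normal_Form.Char_Poly"
begin

text \<open>
  Simple graphs are the finite symmetric loop-free digraphs without multiple arcs of the locale
  \<^locale>\<open>graph\<close>, here with vertex set \<open>{1..n}\<close>.
\<close>

definition num_walks :: "('a, 'b) pre_digraph \<Rightarrow> nat \<Rightarrow> 'a \<Rightarrow> nat" where
  "num_walks G k i = card {p. \<exists>j. pre_digraph.awalk G i p j \<and> length p = k}"

text \<open>Matrix indices start at 0, so vertex \<open>i\<close> has index \<open>i - 1\<close>.\<close>

definition adjacency_matrix :: "(nat, 'b) pre_digraph \<Rightarrow> real mat" where
  "adjacency_matrix G =
     mat (card (verts G)) (card (verts G)) (\<lambda>(i, j). if (Suc i, Suc j) \<in> arcs_ends G then 1 else 0)"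

definition largest_eigenvalue :: "(nat, 'b) pre_digraph \<Rightarrow> real" where
  "largest_eigenvalue G = Max {x. eigenvalue (adjacency_matrix G) x}"

text \<open>
  The eigenvalues are taken with multiplicity. As the adjacency matrix is real symmetric, its
  characteristic polynomial splits over the reals, so all \<open>n\<close> of them are real roots.
\<close>

definition estrada_index :: "(nat, 'b) pre_digraph \<Rightarrow> real" where
  "estrada_index G = (\<Sum>x\<in>#proots (char_poly (adjacency_matrix G)). exp x)"

definition walk_ratio :: "('a, 'b) pre_digraph \<Rightarrow> nat \<Rightarrow> real" where
  "walk_ratio G k =
     sqrt ((\<Sum>i\<in>verts G. (real (num_walks G (k + 1) i))\<^sup>2) / (\<Sum>i\<in>verts G. (real (num_walks G k i))\<^sup>2))"

definition phi :: "nat \<Rightarrow> real \<Rightarrow> real" where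
  "phi n x = exp x + (real n - 1) - x"

end

theory Submission
  imports Defs "Jordan_Normal_Form.Schur_Decomposition" "HOL-Analysis.Convex"
begin

text \<open>
  Let \<open>A\<close> be the adjacency matrix, so that \<open>d\<^sub>k(i)\<close> is the \<open>i\<close>-th row sum of \<open>A\<^sup>k\<close>, and put
  \<open>s\<^sub>k = \<Sum>\<^sub>i d\<^sub>k(i)\<^sup>2\<close>. Symmetry of \<open>A\<close> gives \<open>s\<^sub>k\<^sub>+\<^sub>1 = \<Sum>\<^sub>i d\<^sub>k(i) d\<^sub>k\<^sub>+\<^sub>2(i)\<close>, hence by Cauchy-Schwarz the
  ratios \<open>s\<^sub>k\<^sub>+\<^sub>1 / s\<^sub>k\<close> increase.

  Their limit is found without eigenvectors, from traces of powers. As \<open>A\<^sup>k\<close> is symmetric and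
  nonnegative, the sum of its squared entries is \<open>tr A\<^sup>2\<^sup>k = \<Sum>\<^sub>i \<lambda>\<^sub>i\<^sup>2\<^sup>k\<close>, and
  \<open>tr A\<^sup>2\<^sup>k \<le> s\<^sub>k \<le> n tr A\<^sup>2\<^sup>k\<close>. Since the odd traces are nonnegative, no eigenvalue is below
  \<open>- \<lambda>\<^sub>1\<close>, so \<open>s\<^sub>k\<close> lies between \<open>\<lambda>\<^sub>1\<^sup>2\<^sup>k\<close> and \<open>n\<^sup>2 \<lambda>\<^sub>1\<^sup>2\<^sup>k\<close>; an increasing sequence of ratios must
  then tend to \<open>\<lambda>\<^sub>1\<^sup>2\<close> from below.

  The bound on the Estrada index is \<open>e\<^sup>x \<ge> 1 + x\<close> applied to \<open>\<lambda>\<^sub>2, \<dots>, \<lambda>\<^sub>n\<close>, whose sum is \<open>- \<lambda>\<^sub>1 \<noteq> 0\<close>.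
\<close>

section \<open>Traces of matrix powers as power sums of eigenvalues\<close>

definition mat_trace :: "'a :: comm_monoid_add mat \<Rightarrow> 'a" where
  "mat_trace A = (\<Sum>i<dim_row A. A $$ (i, i))"

lemma mat_trace_mult_comm:
  fixes A B :: "'a :: comm_semiring_0 mat"
  assumes "A \<in> carrier_mat n m" "B \<in> carrier_mat m n"
  shows "mat_trace (A * B) = mat_trace (B * A)"
proof -
  have "mat_trace (A * B) = (\<Sum>i<n. \<Sum>j<m. A $$ (i, j) * B $$ (j, i))"
    using assms by (auto simp: mat_trace_def scalar_prod_def atLeast0LessThan intro!: sum.cong)
  also have "\<dots> = (\<Sum>j<m. \<Sum>i<n. B $$ (j, i) * A $$ (i, j))"
    by (subst sum.swap) (simp add: mult.commute)
  also have "\<dots> = mat_trace (B * A)"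
    using assms by (auto simp: mat_trace_def scalar_prod_def atLeast0LessThan intro!: sum.cong)
  finally show ?thesis .
qed

lemma mat_trace_similar:
  fixes A B :: "'a :: comm_ring_1 mat"
  assumes "similar_mat_wit A B P Q"
  shows "mat_trace A = mat_trace B"
proof -
  define n where "n = dim_row A"
  note D = similar_mat_witD[OF n_def assms]
  have "mat_trace A = mat_trace (P * (B * Q))"
    using D by (simp add: assoc_mult_mat[of P n n B n Q n])
  also have "\<dots> = mat_trace (B * Q * P)"
    using D by (intro mat_trace_mult_comm[of _ n n]) auto
  also have "B * Q * P = B"
    using D by (simp add: assoc_mult_mat[of B n n Q n P n])
  finally show ?thesis .
qed

text \<open>In the entry (i, j) of a product of upper triangular matrices, only middle indices
  between i and j contribute: none below the diagonal, exactly one on it.\<close>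

lemma upper_triangular_pow:
  fixes B :: "'a :: comm_ring_1 mat"
  assumes B: "B \<in> carrier_mat n n" and ut: "upper_triangular B"
  shows "upper_triangular (B ^\<^sub>m k) \<and> (\<forall>i<n. (B ^\<^sub>m k) $$ (i, i) = (B $$ (i, i)) ^ k)"
proof (induction k)
  case 0
  then show ?case using B by auto
next
  case (Suc k)
  let ?C = "B ^\<^sub>m k"
  have C: "?C \<in> carrier_mat n n" using B by simp
  have entry: "(?C * B) $$ (i, j) = (\<Sum>l<n. ?C $$ (i, l) * B $$ (l, j))" if "i < n" "j < n" for i j
    using that B C by (auto simp: scalar_prod_def atLeast0LessThan intro!: sum.cong)
  have zero: "?C $$ (i, l) * B $$ (l, j) = 0" if "i < n" "l < n" "l < i \<or> j < l" for i j l
    using that Suc.IH ut B C upper_triangularD[of ?C l i] upper_triangularD[of B j l] by auto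
  have "upper_triangular (?C * B)"
  proof (rule upper_triangularI)
    fix i j assume ij: "j < i" "i < dim_row (?C * B)"
    then have "i < n" "j < n" using B by auto
    moreover have "l < i \<or> j < l" for l using ij by auto
    ultimately show "(?C * B) $$ (i, j) = 0"
      by (subst entry) (auto intro!: sum.neutral zero)
  qed
  moreover have "(?C * B) $$ (i, i) = (B $$ (i, i)) ^ Suc k" if i: "i < n" for i
  proof -
    have "(?C * B) $$ (i, i) = (\<Sum>l<n. if l = i then ?C $$ (i, i) * B $$ (i, i) else 0)"
      unfolding entry[OF i i] using zero[OF i, of _ i]
      by (intro sum.cong) (auto simp: neq_iff)
    then show ?thesis using i Suc.IH by (simp add: mult.commute)
  qed
  ultimately show ?case by simp
qed

text \<open>Schur decomposition yields a similar upper triangular matrix with diagonal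
  \<open>es\<close>, and similarity preserves the trace of every power.\<close>

lemma mat_trace_pow:
  fixes A :: "real mat"
  assumes A: "A \<in> carrier_mat n n" and cp: "char_poly A = (\<Prod>e\<leftarrow>es. [:- e, 1:])"
  shows "mat_trace (A ^\<^sub>m k) = (\<Sum>e\<leftarrow>es. e ^ k)"
proof -
  obtain B P Q where "schur_decomposition A es = (B, P, Q)"
    by (cases "schur_decomposition A es") auto
  from schur_decomposition[OF A cp this]
  have wit: "similar_mat_wit A B P Q" and ut: "upper_triangular B" and diag: "diag_mat B = es"
    by auto
  have B: "B \<in> carrier_mat n n" using similar_mat_witD2[OF A wit] by auto
  have "mat_trace (A ^\<^sub>m k) = mat_trace (B ^\<^sub>m k)"
    by (rule mat_trace_similar[OF similar_mat_wit_pow[OF wit]])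
  also have "\<dots> = (\<Sum>i<n. (B $$ (i, i)) ^ k)"
    using upper_triangular_pow[OF B ut, of k] B by (simp add: mat_trace_def)
  also have "\<dots> = (\<Sum>e\<leftarrow>es. e ^ k)"
    using B unfolding diag[symmetric] diag_mat_def
    by (simp add: comp_def interv_sum_list_conv_sum_set_nat atLeast0LessThan)
  finally show ?thesis .
qed

section \<open>Real spectrum of real symmetric matrices\<close>

lemma symmetric_matD:
  assumes "A \<in> carrier_mat n n" "A\<^sup>T = A" "i < n" "j < n"
  shows "A $$ (i, j) = A $$ (j, i)"
  using assms by (metis carrier_matD index_transpose_mat(1))

text \<open>The Hermitian form \<open>F\<close> of \<open>A\<close> at an eigenvector is
  \<open>a\<close> times the squared norm \<open>N\<close>. Symmetry makes \<open>F\<close> its own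
  conjugate, so \<open>a\<close> is a quotient of reals.\<close>

lemma eigenvalue_complex_of_real_symmetric:
  fixes A :: "real mat"
  assumes A: "A \<in> carrier_mat n n" and sym: "A\<^sup>T = A"
    and ev: "eigenvalue (map_mat complex_of_real A) a"
  shows "a \<in> \<real>"
proof -
  let ?A = "map_mat complex_of_real A"
  obtain v where v: "v \<in> carrier_vec n" "v \<noteq> 0\<^sub>v n" "?A *\<^sub>v v = a \<cdot>\<^sub>v v"
    using ev A unfolding eigenvalue_def eigenvector_def by auto
  note symE = symmetric_matD[OF A sym]
  define N where "N = (\<Sum>i<n. (cmod (v $ i))\<^sup>2)"
  define F where "F = (\<Sum>i<n. \<Sum>j<n. of_real (A $$ (i, j)) * v $ j * cnj (v $ i))"
  have row: "(\<Sum>j<n. of_real (A $$ (i, j)) * v $ j) = a * v $ i" if "i < n" for i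
  proof -
    have "(?A *\<^sub>v v) $ i = (\<Sum>j<n. of_real (A $$ (i, j)) * v $ j)"
      using that A v(1) by (auto simp: scalar_prod_def atLeast0LessThan intro!: sum.cong)
    then show ?thesis using that v by simp
  qed
  have "F = (\<Sum>i<n. (a * v $ i) * cnj (v $ i))"
    unfolding F_def by (simp flip: sum_distrib_right add: row)
  also have "\<dots> = a * of_real N"
    unfolding N_def of_real_sum complex_norm_square sum_distrib_left by (simp add: mult.assoc)
  finally have F: "F = a * of_real N" .
  have "cnj F = (\<Sum>i<n. \<Sum>j<n. of_real (A $$ (i, j)) * cnj (v $ j) * v $ i)"
    unfolding F_def by simp
  also have "\<dots> = (\<Sum>j<n. \<Sum>i<n. of_real (A $$ (j, i)) * v $ i * cnj (v $ j))"
    by (subst sum.swap) (auto intro!: sum.cong simp: symE mult_ac)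
  finally have "cnj F = F" unfolding F_def .
  then have "F \<in> \<real>" by (simp add: Reals_cnj_iff)
  moreover have "N \<noteq> 0"
  proof
    assume "N = 0"
    then have "\<forall>i<n. v $ i = 0"
      unfolding N_def by (subst (asm) sum_nonneg_eq_0_iff) auto
    then show False using v by (auto simp: vec_eq_iff)
  qed
  moreover have "a = F / of_real N" using F \<open>N \<noteq> 0\<close> by simp
  ultimately show ?thesis by (metis Reals_divide Reals_of_real)
qed

text \<open>The polynomial splits over the complex numbers with real roots only; the factorization
  descends because the embedding of real polynomials is injective.\<close>

lemma char_poly_real_symmetric_splits:
  fixes A :: "real mat"
  assumes A: "A \<in> carrier_mat n n" and sym: "A\<^sup>T = A"
  shows "\<exists>es. char_poly A = (\<Prod>e\<leftarrow>es. [:- e, 1:]) \<and> length es = n"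
proof -
  let ?A = "map_mat complex_of_real A"
  have cA: "?A \<in> carrier_mat n n" using A by simp
  obtain as where cp: "char_poly ?A = (\<Prod>a\<leftarrow>as. [:- a, 1:])" and len: "length as = n"
    using char_poly_factorized[OF cA] by auto
  have real: "of_real (Re a) = a" if "a \<in> set as" for a
  proof -
    have "poly (char_poly ?A) a = 0"
      unfolding cp using that by (rule linear_poly_root)
    then have "eigenvalue ?A a" using eigenvalue_root_char_poly[OF cA] by simp
    then show ?thesis using eigenvalue_complex_of_real_symmetric[OF A sym] by simp
  qed
  interpret P: map_poly_inj_idom_hom complex_of_real ..
  have "map_poly complex_of_real (\<Prod>e\<leftarrow>map Re as. [:- e, 1:]) = (\<Prod>a\<leftarrow>as. [:- a, 1:])"
    unfolding P.hom_prod_list map_map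
    by (rule arg_cong[where f = prod_list]) (auto simp: real intro!: map_cong)
  also have "\<dots> = map_poly complex_of_real (char_poly A)"
    using of_real_hom.char_poly_hom[OF A, where 'a = complex] cp by simp
  finally have "char_poly A = (\<Prod>e\<leftarrow>map Re as. [:- e, 1:])"
    by simp
  with len show ?thesis by (metis length_map)
qed

section \<open>Powers of symmetric and of nonnegative matrices\<close>

lemma pow_mat_add:
  fixes A :: "'a :: semiring_1 mat"
  assumes A: "A \<in> carrier_mat n n"
  shows "A ^\<^sub>m (k + l) = A ^\<^sub>m k * A ^\<^sub>m l"
proof (induction l)
  case 0
  then show ?case using A by simp
next
  case (Suc l)
  then show ?case using A by (simp add: assoc_mult_mat[of _ n n _ n _ n])
qed

lemma transpose_pow_mat:
  fixes A :: "'a :: comm_semiring_1 mat"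
  assumes A: "A \<in> carrier_mat n n"
  shows "(A ^\<^sub>m k)\<^sup>T = A\<^sup>T ^\<^sub>m k"
proof (induction k)
  case 0
  then show ?case using A by simp
next
  case (Suc k)
  have "(A ^\<^sub>m Suc k)\<^sup>T = A\<^sup>T * A\<^sup>T ^\<^sub>m k"
    using A Suc.IH by (simp add: transpose_mult[of _ n n _ n])
  also have "\<dots> = A\<^sup>T ^\<^sub>m 1 * A\<^sup>T ^\<^sub>m k"
    using A by simp
  also have "\<dots> = A\<^sup>T ^\<^sub>m Suc k"
    using pow_mat_add[of "A\<^sup>T" n 1 k] A by simp
  finally show ?case .
qed

lemma pow_mat_nonneg:
  fixes A :: "real mat"
  assumes A: "A \<in> carrier_mat n n" and nn: "\<And>i j. i < n \<Longrightarrow> j < n \<Longrightarrow> A $$ (i, j) \<ge> 0"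
    and "i < n" "j < n"
  shows "(A ^\<^sub>m k) $$ (i, j) \<ge> 0"
  using assms(3,4)
proof (induction k arbitrary: j)
  case 0
  then show ?case using A by simp
next
  case (Suc k)
  have "(A ^\<^sub>m k * A) $$ (i, j) = (\<Sum>l<n. (A ^\<^sub>m k) $$ (i, l) * A $$ (l, j))"
    using Suc.prems A by (auto simp: scalar_prod_def atLeast0LessThan intro!: sum.cong)
  also have "\<dots> \<ge> 0"
    using Suc nn by (intro sum_nonneg mult_nonneg_nonneg) auto
  finally show ?case by simp
qed

text \<open>The extra factor is split off on the left, unlike in the recursion of
  \<open>^\<^sub>m\<close>, to match the counting of walks by their first arc.\<close>

lemma pow_mat_row_sum_Suc:
  fixes A :: "'a :: comm_semiring_1 mat"
  assumes A: "A \<in> carrier_mat n n" and i: "i < n"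
  shows "(\<Sum>j<n. (A ^\<^sub>m Suc k) $$ (i, j)) = (\<Sum>l<n. A $$ (i, l) * (\<Sum>j<n. (A ^\<^sub>m k) $$ (l, j)))"
proof -
  have "A ^\<^sub>m Suc k = A * A ^\<^sub>m k"
    using pow_mat_add[OF A, of 1 k] A by simp
  then have "(\<Sum>j<n. (A ^\<^sub>m Suc k) $$ (i, j)) = (\<Sum>j<n. \<Sum>l<n. A $$ (i, l) * (A ^\<^sub>m k) $$ (l, j))"
    using A i by (auto simp: scalar_prod_def atLeast0LessThan intro!: sum.cong)
  also have "\<dots> = (\<Sum>l<n. A $$ (i, l) * (\<Sum>j<n. (A ^\<^sub>m k) $$ (l, j)))"
    by (subst sum.swap) (simp add: sum_distrib_left)
  finally show ?thesis .
qed

text \<open>The power \<open>A ^\<^sub>m m\<close> is itself symmetric, so the trace of its square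
  is its squared Frobenius norm.\<close>

lemma mat_trace_even_pow:
  fixes A :: "'a :: comm_semiring_1 mat"
  assumes A: "A \<in> carrier_mat n n" and sym: "A\<^sup>T = A"
  shows "mat_trace (A ^\<^sub>m (2 * m)) = (\<Sum>i<n. \<Sum>j<n. ((A ^\<^sub>m m) $$ (i, j))\<^sup>2)"
proof -
  let ?B = "A ^\<^sub>m m"
  have B: "?B \<in> carrier_mat n n" using A by simp
  have "?B\<^sup>T = ?B" using transpose_pow_mat[OF A] sym by simp
  note symB = symmetric_matD[OF B this]
  have "mat_trace (A ^\<^sub>m (2 * m)) = mat_trace (?B * ?B)"
    using pow_mat_add[OF A, of m m] by (simp add: mult_2)
  also have "\<dots> = (\<Sum>i<n. \<Sum>j<n. ?B $$ (i, j) * ?B $$ (j, i))"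
    using A B by (auto simp: mat_trace_def scalar_prod_def atLeast0LessThan intro!: sum.cong)
  also have "\<dots> = (\<Sum>i<n. \<Sum>j<n. (?B $$ (i, j))\<^sup>2)"
    using symB by (auto simp: power2_eq_square intro!: sum.cong)
  finally show ?thesis .
qed

section \<open>Growth rates of real sequences\<close>

lemma sum_squares_le_square_sum:
  fixes f :: "'a \<Rightarrow> real"
  assumes "finite I" "\<And>i. i \<in> I \<Longrightarrow> f i \<ge> 0"
  shows "(\<Sum>i\<in>I. (f i)\<^sup>2) \<le> (\<Sum>i\<in>I. f i)\<^sup>2"
proof -
  have "(\<Sum>i\<in>I. (f i)\<^sup>2) \<le> (\<Sum>i\<in>I. f i * (\<Sum>j\<in>I. f j))"
    unfolding power2_eq_square using assms
    by (intro sum_mono mult_left_mono member_le_sum) auto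
  then show ?thesis by (simp add: power2_eq_square sum_distrib_right)
qed

text \<open>Otherwise division by \<open>r ^ m\<close> would bound \<open>c\<close> by
  \<open>C * (s / r) ^ m\<close>, which tends to 0.\<close>

lemma le_if_power_bound:
  fixes r s c C :: real
  assumes c: "c > 0" and s: "s \<ge> 0" and le: "\<And>m. c * r ^ m \<le> C * s ^ m"
  shows "r \<le> s"
proof (rule ccontr)
  assume "\<not> r \<le> s"
  with s have r: "r > 0" "s < r" by auto
  have "(\<lambda>m. C * (s / r) ^ m) \<longlonglongrightarrow> C * 0"
    using r s by (intro tendsto_intros LIMSEQ_power_zero) auto
  moreover have "c \<le> C * (s / r) ^ m" for m
    using le[of m] r by (simp add: power_divide field_simps)
  ultimately have "c \<le> C * 0" by (intro LIMSEQ_le_const) auto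
  with c show False by simp
qed

text \<open>If a ratio exceeded \<open>r\<close>, all later ones would too, and \<open>a\<close>
  would outgrow the upper bound. If the limit of the ratios were below \<open>r\<close>,
  \<open>a\<close> would grow too slowly for the lower bound.\<close>

lemma incseq_ratio_limit:
  fixes a :: "nat \<Rightarrow> real"
  assumes pos: "\<And>k. a k > 0" and inc: "incseq (\<lambda>k. a (Suc k) / a k)"
    and c: "c > 0" and r: "r \<ge> 0"
    and lower: "\<And>k. c * r ^ k \<le> a k" and upper: "\<And>k. a k \<le> C * r ^ k"
  shows "\<And>k. a (Suc k) / a k \<le> r" and "(\<lambda>k. a (Suc k) / a k) \<longlonglongrightarrow> r"
proof -
  define q where "q k = a (Suc k) / a k" for k
  have q: "a (Suc k) = a k * q k" "q k \<ge> 0" for k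
    using pos[of k] pos[of "Suc k"] by (auto simp: q_def)
  have inc: "incseq q" using inc unfolding q_def[abs_def] .
  have "a k * q k ^ m \<le> a (k + m)" for k m
  proof (induction m)
    case (Suc m)
    have "a k * q k ^ Suc m \<le> a (k + m) * q k"
      using mult_right_mono[OF Suc q(2)[of k]] by (simp add: mult_ac)
    also have "\<dots> \<le> a (k + m) * q (k + m)"
      using incseqD[OF inc, of k "k + m"] pos[of "k + m"] by (intro mult_left_mono) auto
    finally show ?case using q(1)[of "k + m"] by simp
  qed simp
  then have "a k * q k ^ m \<le> (C * r ^ k) * r ^ m" for k m
    using order_trans[OF _ upper[of "k + m"]] by (simp add: mult.assoc power_add)
  then have q_le: "q k \<le> r" for k using pos r by (rule le_if_power_bound[rotated 2])
  then show "\<And>k. a (Suc k) / a k \<le> r" by (simp add: q_def)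
  obtain L where L: "q \<longlonglongrightarrow> L" "\<And>k. q k \<le> L"
    using incseq_convergent[OF inc, of r] q_le by auto
  have "a m \<le> a 0 * L ^ m" for m
  proof (induction m)
    case (Suc m)
    have "a (Suc m) \<le> a m * L" using q(1)[of m] L(2)[of m] pos[of m] by simp
    also have "\<dots> \<le> a 0 * L ^ m * L"
      using Suc order_trans[OF q(2) L(2)] by (intro mult_right_mono) auto
    finally show ?case by (simp add: mult_ac)
  qed simp
  then have "c * r ^ m \<le> a 0 * L ^ m" for m using lower order_trans by blast
  then have "r \<le> L" using c order_trans[OF q(2) L(2)] by (rule le_if_power_bound[rotated 2])
  moreover have "L \<le> r" using L(1) q_le by (intro LIMSEQ_le_const2) auto
  ultimately show "(\<lambda>k. a (Suc k) / a k) \<longlonglongrightarrow> r"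
    using L(1) unfolding q_def[abs_def] by simp
qed

text \<open>If an element \<open>e < - Max (set es)\<close> existed, then \<open>e ^ (2 * m + 1)\<close> would make the sum negative
  for large \<open>m\<close>.\<close>

lemma abs_le_Max_if_odd_power_sums_nonneg:
  fixes es :: "real list"
  assumes odd: "\<And>m. (\<Sum>x\<leftarrow>es. x ^ (2 * m + 1)) \<ge> 0" and e: "e \<in> set es"
  shows "\<bar>e\<bar> \<le> Max (set es)"
proof -
  define M where "M = Max (set es)"
  have le: "x \<le> M" if "x \<in> set es" for x unfolding M_def using that by simp
  have split: "(\<Sum>x\<leftarrow>es. x ^ (2 * m + 1))
      \<le> e ^ (2 * m + 1) + real (length es - 1) * M ^ (2 * m + 1)" for m
  proof -
    have "(\<Sum>x\<leftarrow>remove1 e es. x ^ (2 * m + 1)) \<le> (\<Sum>x\<leftarrow>remove1 e es. M ^ (2 * m + 1))"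
      using le set_remove1_subset[of e es] by (intro sum_list_mono power_mono_odd) auto
    also have "\<dots> = real (length es - 1) * M ^ (2 * m + 1)"
      using e by (simp add: sum_list_triv length_remove1)
    finally show ?thesis
      using sum_list_map_remove1[OF e, of "\<lambda>x. x ^ (2 * m + 1)"] by simp
  qed
  show ?thesis
  proof (cases "e \<ge> 0")
    case True
    then show ?thesis using le[OF e] M_def by simp
  next
    case False
    \<comment> \<open>Exponent 1 already forces \<open>M\<close> to be nonnegative, which is what
      later turns a bound on squares into one on absolute values.\<close>
    have "0 \<le> e + real (length es - 1) * M" using odd[of 0] split[of 0] by simp
    with False have "real (length es - 1) * M > 0" by linarith
    then have M: "M \<ge> 0" by (simp add: zero_less_mult_iff)
    \<comment> \<open>Splitting one factor off each odd power leaves a comparison of geometric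
      growth with ratios \<open>e\<^sup>2\<close> and \<open>M\<^sup>2\<close>.\<close>
    have "(- e) * (e\<^sup>2) ^ m \<le> (real (length es - 1) * M) * (M\<^sup>2) ^ m" for m
      using odd[of m] split[of m] by (simp add: power_mult[symmetric] algebra_simps)
    then have "e\<^sup>2 \<le> M\<^sup>2" using False by (elim le_if_power_bound[rotated 2]) auto
    then show ?thesis using M M_def by (simp add: power2_le_iff_abs_le)
  qed
qed

section \<open>Ratios of squared row sums for nonnegative symmetric matrices\<close>

text \<open>An instance of \<open>incseq_ratio_limit\<close> with \<open>r\<close> the square of the
  largest eigenvalue, \<open>c = 1\<close> and \<open>C\<close> the square of
  \<open>n\<close>.\<close>

lemma pow_mat_row_sum_square_ratio:
  fixes A :: "real mat" and n :: nat
  defines "a \<equiv> \<lambda>m. \<Sum>i<n. (\<Sum>j<n. (A ^\<^sub>m m) $$ (i, j))\<^sup>2"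
  assumes A: "A \<in> carrier_mat n n" and sym: "A\<^sup>T = A"
    and nn: "\<And>i j. i < n \<Longrightarrow> j < n \<Longrightarrow> A $$ (i, j) \<ge> 0"
    and cp: "char_poly A = (\<Prod>e\<leftarrow>es. [:- e, 1:])" and n: "length es = n"
    and pos: "\<And>m. a m > 0"
  shows "incseq (\<lambda>m. a (Suc m) / a m)"
    and "\<And>m. a (Suc m) / a m \<le> (Max (set es))\<^sup>2"
    and "(\<lambda>m. a (Suc m) / a m) \<longlonglongrightarrow> (Max (set es))\<^sup>2"
    and "Max (set es) > 0"
proof -
  define d where "d m i = (\<Sum>j<n. (A ^\<^sub>m m) $$ (i, j))" for m i
  define b where "b = a"
  define M where "M = Max (set es)"
  have b: "b m = (\<Sum>i<n. (d m i)\<^sup>2)" "b m > 0" for m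
    using pos unfolding b_def a_def d_def by auto
  have d_Suc: "d (Suc m) i = (\<Sum>l<n. A $$ (i, l) * d m l)" if "i < n" for m i
    unfolding d_def using pow_mat_row_sum_Suc[OF A that] .
  \<comment> \<open>One factor \<open>A\<close> moves across the inner product of
    \<open>d (Suc m)\<close> with itself, by symmetry.\<close>
  have "b (Suc m) = (\<Sum>i<n. d m i * d (Suc (Suc m)) i)" for m
  proof -
    have "b (Suc m) = (\<Sum>i<n. \<Sum>l<n. A $$ (i, l) * d m l * d (Suc m) i)"
      unfolding b power2_eq_square by (auto simp: d_Suc sum_distrib_right intro!: sum.cong)
    also have "\<dots> = (\<Sum>l<n. d m l * (\<Sum>i<n. A $$ (l, i) * d (Suc m) i))"
      by (subst sum.swap)
        (auto simp: sum_distrib_left mult_ac symmetric_matD[OF A sym] intro!: sum.cong)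
    also have "\<dots> = (\<Sum>l<n. d m l * d (Suc (Suc m)) l)"
      by (simp add: d_Suc)
    finally show ?thesis .
  qed
  then have "(b (Suc m))\<^sup>2 \<le> b m * b (Suc (Suc m))" for m
    unfolding b(1)[of m] b(1)[of "Suc (Suc m)"] by (simp only: Cauchy_Schwarz_ineq_sum)
  then have "b (Suc m) / b m \<le> b (Suc (Suc m)) / b (Suc m)" for m
    using b(2)[of m] b(2)[of "Suc m"] by (simp add: field_simps power2_eq_square)
  then have inc: "incseq (\<lambda>m. b (Suc m) / b m)" by (intro incseq_SucI) auto
  have trace: "mat_trace (A ^\<^sub>m m) = (\<Sum>e\<leftarrow>es. e ^ m)" for m
    using mat_trace_pow[OF A cp] .
  have "mat_trace (A ^\<^sub>m m) \<ge> 0" for m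
    using pow_mat_nonneg[OF A nn] A by (auto simp: mat_trace_def intro!: sum_nonneg)
  then have abs_le: "\<bar>e\<bar> \<le> M" if "e \<in> set es" for e
    unfolding M_def using that unfolding trace by (intro abs_le_Max_if_odd_power_sums_nonneg)
  have "n \<noteq> 0" using b[of 0] by (intro notI) simp
  then have M_in: "M \<in> set es" unfolding M_def using n by (intro Max_in) auto
  then have M0: "M \<ge> 0" using abs_le[of M] by linarith
  have sq: "mat_trace (A ^\<^sub>m (2 * m)) = (\<Sum>i<n. \<Sum>j<n. ((A ^\<^sub>m m) $$ (i, j))\<^sup>2)" for m
    by (rule mat_trace_even_pow[OF A sym])
  \<comment> \<open>Of the trace of \<open>A ^\<^sub>m (2 * m)\<close> only the summand of the
    eigenvalue \<open>M\<close> is kept.\<close>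
  have lower: "1 * (M\<^sup>2) ^ m \<le> b m" for m
  proof -
    have "(M\<^sup>2) ^ m \<le> (\<Sum>e\<leftarrow>es. (e\<^sup>2) ^ m)"
      using M_in by (intro member_le_sum_list) auto
    also have "\<dots> = (\<Sum>i<n. \<Sum>j<n. ((A ^\<^sub>m m) $$ (i, j))\<^sup>2)"
      using sq[of m] trace[of "2 * m"] by (simp add: power_mult)
    also have "\<dots> \<le> b m"
      unfolding b d_def using pow_mat_nonneg[OF A nn]
      by (intro sum_mono sum_squares_le_square_sum) auto
    finally show ?thesis by simp
  qed
  \<comment> \<open>One factor \<open>n\<close> comes from Cauchy-Schwarz in each row, the other
    from bounding all \<open>n\<close> eigenvalues by \<open>M\<close> in absolute value.\<close>
  have upper: "b m \<le> (real n * real n) * (M\<^sup>2) ^ m" for m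
  proof -
    have "b m \<le> (\<Sum>i<n. real n * (\<Sum>j<n. ((A ^\<^sub>m m) $$ (i, j))\<^sup>2))"
      unfolding b d_def
      using sum_squared_le_sum_of_squares[where I = "{..<n}"]
      by (intro sum_mono) (simp add: mult.commute)
    also have "\<dots> = real n * (\<Sum>e\<leftarrow>es. (e\<^sup>2) ^ m)"
      using sq[of m] trace[of "2 * m"] by (simp add: power_mult sum_distrib_left)
    also have "(\<Sum>e\<leftarrow>es. (e\<^sup>2) ^ m) \<le> (\<Sum>e\<leftarrow>es. (M\<^sup>2) ^ m)"
      using abs_le M0 by (intro sum_list_mono power_mono[of "_\<^sup>2"]) (auto simp: power2_le_iff_abs_le)
    finally show ?thesis using n by (simp add: sum_list_triv mult_left_mono mult.assoc)
  qed
  have "M \<noteq> 0" using upper[of 1] b(2)[of 1] by auto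
  with M0 show "Max (set es) > 0" unfolding M_def by simp
  show "incseq (\<lambda>m. a (Suc m) / a m)" using inc unfolding b_def .
  show "\<And>m. a (Suc m) / a m \<le> (Max (set es))\<^sup>2"
    and "(\<lambda>m. a (Suc m) / a m) \<longlonglongrightarrow> (Max (set es))\<^sup>2"
    using incseq_ratio_limit[OF b(2) inc _ _ lower upper] unfolding b_def M_def by auto
qed

section \<open>Exponential inequalities\<close>

text \<open>A nonzero sum has a nonzero summand, and there the tangent bound on \<open>exp\<close>
  is strict.\<close>

lemma sum_list_exp_gt:
  fixes xs :: "real list"
  assumes "sum_list xs \<noteq> 0"
  shows "(\<Sum>x\<leftarrow>xs. exp x) > real (length xs) + sum_list xs"
proof -
  have ge: "(\<Sum>x\<leftarrow>xs. exp x) \<ge> real (length xs) + sum_list xs" for xs :: "real list"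
  proof (induction xs)
    case (Cons x xs)
    then show ?case using exp_ge_add_one_self[of x] by (simp del: exp_ge_add_one_self)
  qed simp
  \<comment> \<open>Equality would be the equality case of ln y \<le> y - 1 at y =
    \<open>exp x\<close>, forcing y = 1.\<close>
  have strict: "exp x > 1 + x" if "x \<noteq> 0" for x :: real
    using that exp_ge_add_one_self[of x] ln_eq_minus_one[of "exp x"]
    by (simp add: less_le del: exp_ge_add_one_self) force
  show ?thesis using assms
  proof (induction xs)
    case (Cons x xs)
    then show ?case
      using ge[of xs] exp_ge_add_one_self[of x] strict[of x]
      by (cases "x = 0") (auto simp del: exp_ge_add_one_self)
  qed simp
qed

text \<open>With one copy of the maximum removed, the rest sums to its negative, which is nonzero;
  hence the strict tangent bound applies to the rest.\<close>

lemma sum_list_exp_gt_phi_Max: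
  fixes es :: "real list"
  assumes "sum_list es = 0" "Max (set es) > 0" "es \<noteq> []"
  shows "(\<Sum>e\<leftarrow>es. exp e) > phi (length es) (Max (set es))"
proof -
  let ?M = "Max (set es)"
  have M: "?M \<in> set es" using assms by (intro Max_in) auto
  have sum: "sum_list (remove1 ?M es) = - ?M"
    using sum_list_map_remove1[OF M, of "\<lambda>x. x"] assms(1) by simp
  have "(\<Sum>e\<leftarrow>es. exp e) = exp ?M + (\<Sum>e\<leftarrow>remove1 ?M es. exp e)"
    by (rule sum_list_map_remove1[OF M])
  also have "\<dots> > exp ?M + (real (length es - 1) - ?M)"
    using sum_list_exp_gt[of "remove1 ?M es"] sum assms(2) M by (simp add: length_remove1)
  finally show ?thesis using assms(3) by (cases es) (auto simp: phi_def)
qed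

text \<open>Factoring \<open>exp x\<close> out of \<open>exp y - exp x\<close> leaves
  \<open>exp (y - x) - 1\<close>, at least \<open>y - x\<close>; the factor is at least 1 since
  \<open>x\<close> is nonnegative.\<close>

lemma phi_mono:
  assumes "0 \<le> x" "x \<le> y"
  shows "phi n x \<le> phi n y"
proof -
  have "exp x * (exp (y - x) - 1) \<ge> 1 * (y - x)"
    using assms exp_ge_add_one_self[of "y - x"] unfolding le_diff_eq[symmetric]
    by (intro mult_mono) (auto simp del: exp_ge_add_one_self)
  then show ?thesis by (simp add: phi_def algebra_simps flip: exp_add)
qed

section \<open>Eigenvalues as roots of the characteristic polynomial\<close>

lemma proots_prod_linear_factors:
  fixes es :: "'a :: idom list"
  shows "proots (\<Prod>e\<leftarrow>es. [:- e, 1:]) = mset es"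
proof (induction es)
  case (Cons e es)
  have "(\<Prod>e\<leftarrow>es. [:- e, 1:]) \<noteq> 0" by (auto simp: prod_list_zero_iff)
  then show ?case using Cons by (simp add: proots_mult del: mult_pCons_left)
qed simp

lemma eigenvalues_linear_factors:
  fixes A :: "'a :: field mat"
  assumes A: "A \<in> carrier_mat n n" and cp: "char_poly A = (\<Prod>e\<leftarrow>es. [:- e, 1:])"
  shows "{x. eigenvalue A x} = set es"
proof -
  have "char_poly A \<noteq> 0" unfolding cp by (auto simp: prod_list_zero_iff)
  then have "{x. eigenvalue A x} = set_mset (proots (char_poly A))"
    using eigenvalue_root_char_poly[OF A] by simp
  then show ?thesis by (simp add: cp proots_prod_linear_factors)
qed

section \<open>Walk counts and connectivity\<close>

lemma (in fin_digraph) finite_walks: "finite {p. \<exists>v. awalk u p v \<and> length p = k}"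
  by (rule finite_subset[OF _ finite_lists_length_eq[OF finite_arcs, of k]]) auto

text \<open>Walks are partitioned by their first arc.\<close>

lemma (in fin_digraph) num_walks_Suc:
  "num_walks G (Suc k) u = (\<Sum>e\<in>{e \<in> arcs G. tail G e = u}. num_walks G k (head G e))"
proof -
  let ?W = "\<lambda>u k. {p. \<exists>v. awalk u p v \<and> length p = k}"
  let ?E = "{e \<in> arcs G. tail G e = u}"
  have "?W u (Suc k) = (\<Union>e\<in>?E. (#) e ` ?W (head G e) k)"
    by (auto simp: length_Suc_conv awalk_Cons_iff image_iff)
  then have "card (?W u (Suc k)) = (\<Sum>e\<in>?E. card ((#) e ` ?W (head G e) k))"
    using finite_walks by (simp, intro card_UN_disjoint) auto
  also have "\<dots> = (\<Sum>e\<in>?E. card (?W (head G e) k))"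
    by (intro sum.cong card_image) auto
  finally show ?thesis unfolding num_walks_def .
qed

text \<open>Without parallel arcs, \<open>head G\<close> maps the arcs leaving \<open>u\<close>
  bijectively to its neighbours.\<close>

lemma (in digraph) num_walks_Suc_neighbours:
  "num_walks G (Suc k) u = (\<Sum>v | (u, v) \<in> arcs_ends G. num_walks G k v)"
  unfolding num_walks_Suc
proof (rule sum.reindex_bij_betw)
  show "bij_betw (head G) {e \<in> arcs G. tail G e = u} {v. (u, v) \<in> arcs_ends G}"
    using no_multi_arcs
    by (auto simp: bij_betw_def inj_on_def arcs_ends_conv arc_to_ends_def image_iff)
qed

lemma adjacency_matrix_carrier:
  "adjacency_matrix G \<in> carrier_mat (card (verts G)) (card (verts G))"
  by (simp add: adjacency_matrix_def)

lemma transpose_adjacency_matrix: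
  fixes G :: "(nat, 'b) pre_digraph"
  assumes "graph G"
  shows "(adjacency_matrix G)\<^sup>T = adjacency_matrix G"
proof -
  interpret graph G by fact
  show ?thesis
    using arcs_ends_symmetric[OF sym_arcs] by (auto simp: adjacency_matrix_def)
qed

text \<open>Both sides start at 1 and obey the same recursion over neighbours; row \<open>i\<close>
  belongs to vertex \<open>Suc i\<close>.\<close>

lemma num_walks_row_sum:
  fixes G :: "(nat, 'b) pre_digraph"
  assumes "graph G" and verts: "verts G = {1..n}" and "i < n"
  shows "real (num_walks G k (Suc i)) = (\<Sum>j<n. (adjacency_matrix G ^\<^sub>m k) $$ (i, j))"
  using \<open>i < n\<close>
proof (induction k arbitrary: i)
  interpret graph G by fact
  let ?A = "adjacency_matrix G"
  have A: "?A \<in> carrier_mat n n" using adjacency_matrix_carrier[of G] verts by simp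
  {
    case 0
    have "{p. \<exists>v. awalk (Suc i) p v \<and> length p = 0} = {[]}"
      using 0 verts by (auto simp: awalk_Nil_iff)
    then show ?case using 0 A by (simp add: num_walks_def)
  next
    case (Suc k)
    have nb: "{v. (Suc i, v) \<in> arcs_ends G} = Suc ` {j. j < n \<and> (Suc i, Suc j) \<in> arcs_ends G}"
    proof -
      have "v \<in> Suc ` {..<n}" if "(Suc i, v) \<in> arcs_ends G" for v
        using adj_in_verts(2)[OF that] verts by (simp add: image_Suc_lessThan)
      then show ?thesis by auto
    qed
    have "real (num_walks G (Suc k) (Suc i))
        = (\<Sum>j | j < n \<and> (Suc i, Suc j) \<in> arcs_ends G. real (num_walks G k (Suc j)))"
      unfolding num_walks_Suc_neighbours nb by (simp add: sum.reindex)
    also have "\<dots> = (\<Sum>j<n. ?A $$ (i, j) * real (num_walks G k (Suc j)))"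
      using Suc.prems verts
      by (intro sum.mono_neutral_cong_left) (auto simp: adjacency_matrix_def)
    also have "\<dots> = (\<Sum>j<n. ?A $$ (i, j) * (\<Sum>l<n. (?A ^\<^sub>m k) $$ (j, l)))"
      using Suc.IH by simp
    also have "\<dots> = (\<Sum>j<n. (?A ^\<^sub>m Suc k) $$ (i, j))"
      using pow_mat_row_sum_Suc[OF A Suc.prems] by simp
    finally show ?case .
  }
qed

text \<open>A path to a second vertex must make a first step.\<close>

lemma (in graph) connected_imp_ex_neighbour:
  assumes "connected G" "card (verts G) \<ge> 2" "u \<in> verts G"
  shows "\<exists>v. (u, v) \<in> arcs_ends G"
proof -
  obtain w where w: "w \<in> verts G" "w \<noteq> u"
    using assms(2,3) by (metis card_le_Suc0_iff_eq finite_verts not_less_eq_eq numeral_2_eq_2)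
  have "u \<rightarrow>\<^sup>* w"
    using symmetric_connected_imp_strongly_connected[OF sym_arcs assms(1)] assms(3) w(1) by auto
  then show ?thesis
    using w(2) by (cases rule: converse_reachable_cases) auto
qed

text \<open>No walk gets stuck, as every vertex has a neighbour. This keeps the denominators in
  \<open>walk_ratio\<close> positive.\<close>

lemma (in graph) num_walks_pos:
  assumes "connected G" "card (verts G) \<ge> 2" "u \<in> verts G"
  shows "num_walks G k u > 0"
  using assms(3)
proof (induction k arbitrary: u)
  case 0
  then have "{p. \<exists>v. awalk u p v \<and> length p = 0} = {[]}" by (auto simp: awalk_Nil_iff)
  then show ?case by (simp add: num_walks_def)
next
  case (Suc k)
  obtain v where v: "(u, v) \<in> arcs_ends G"
    using connected_imp_ex_neighbour[OF assms(1,2) Suc.prems] by auto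
  have "finite {v. (u, v) \<in> arcs_ends G}"
    by (rule finite_subset[OF _ finite_verts]) (auto dest: adj_in_verts)
  then show ?case
    unfolding num_walks_Suc_neighbours
    using v Suc.IH[OF adj_in_verts(2)[OF v]] by (intro sum_pos2[of _ v]) auto
qed

section \<open>Transfer from matrices to graphs\<close>

theorem theorem5:
  fixes G :: "(nat, 'b) pre_digraph" and n :: nat
  assumes "graph G"
    and "Digraph_Component.connected G"
    and "n \<ge> 2"
    and "verts G = {1..n}"
  shows "(\<forall>k. phi n (walk_ratio G k) \<le> phi n (walk_ratio G (k + 1)))
    \<and> (\<lambda>k. phi n (walk_ratio G k)) \<longlonglongrightarrow> phi n (largest_eigenvalue G)
    \<and> (\<forall>k. estrada_index G > exp (walk_ratio G k) + real n - 1 - walk_ratio G k)"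
proof -
  interpret graph G by fact
  let ?A = "adjacency_matrix G"
  have A: "?A \<in> carrier_mat n n" using adjacency_matrix_carrier[of G] assms(4) by simp
  have sym: "?A\<^sup>T = ?A" by (rule transpose_adjacency_matrix) fact
  have nonneg: "?A $$ (i, j) \<ge> 0" if "i < n" "j < n" for i j
    using that assms(4) by (simp add: adjacency_matrix_def)
  obtain es where cp: "char_poly ?A = (\<Prod>e\<leftarrow>es. [:- e, 1:])" and len: "length es = n"
    using char_poly_real_symmetric_splits[OF A sym] by auto
  define a where "a m = (\<Sum>i<n. (\<Sum>j<n. (?A ^\<^sub>m m) $$ (i, j))\<^sup>2)" for m
  have a_walks: "a m = (\<Sum>u\<in>verts G. (real (num_walks G m u))\<^sup>2)" for m
  proof -
    have "verts G = Suc ` {..<n}" using assms(4) by (simp add: image_Suc_lessThan)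
    then show ?thesis
      by (simp add: a_def sum.reindex num_walks_row_sum[OF assms(1,4)])
  qed
  have a_pos: "a m > 0" for m
    unfolding a_walks using assms num_walks_pos by (intro sum_pos) auto
  have "largest_eigenvalue G = Max (set es)"
    unfolding largest_eigenvalue_def eigenvalues_linear_factors[OF A cp] ..
  with pow_mat_row_sum_square_ratio[OF A sym nonneg cp len a_pos[unfolded a_def]]
  have inc: "incseq (\<lambda>m. a (Suc m) / a m)"
    and le: "\<And>m. a (Suc m) / a m \<le> (largest_eigenvalue G)\<^sup>2"
    and lim: "(\<lambda>m. a (Suc m) / a m) \<longlonglongrightarrow> (largest_eigenvalue G)\<^sup>2"
    and pos: "largest_eigenvalue G > 0" and max: "Max (set es) = largest_eigenvalue G"
    unfolding a_def by auto
  have ratio: "walk_ratio G k = sqrt (a (Suc k) / a k)" for k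
    by (simp add: walk_ratio_def a_walks)
  have ratio_nonneg: "walk_ratio G k \<ge> 0" for k
    unfolding ratio by (intro real_sqrt_ge_zero divide_nonneg_nonneg less_imp_le a_pos)
  have "phi n (walk_ratio G k) \<le> phi n (walk_ratio G (k + 1))" for k
    using incseq_SucD[OF inc, of k] ratio_nonneg by (intro phi_mono) (simp_all add: ratio)
  moreover have "(\<lambda>k. phi n (walk_ratio G k)) \<longlonglongrightarrow> phi n (largest_eigenvalue G)"
  proof -
    have "walk_ratio G \<longlonglongrightarrow> largest_eigenvalue G"
      using tendsto_real_sqrt[OF lim] pos by (simp add: ratio[abs_def])
    then show ?thesis unfolding phi_def by (intro tendsto_intros)
  qed
  moreover have "estrada_index G > exp (walk_ratio G k) + real n - 1 - walk_ratio G k" for k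
  proof -
    have "walk_ratio G k \<le> largest_eigenvalue G"
      unfolding ratio using le[of k] pos by (intro real_le_lsqrt) auto
    then have "phi n (walk_ratio G k) \<le> phi n (largest_eigenvalue G)"
      using ratio_nonneg by (rule phi_mono[rotated])
    \<comment> \<open>Exponent 1 in the trace formula: the eigenvalues sum to the trace, which
      vanishes because there are no loops.\<close>
    also have "sum_list es = mat_trace ?A"
      using mat_trace_pow[OF A cp, of 1] A by simp
    then have "sum_list es = 0"
      using adj_not_same by (auto simp: mat_trace_def adjacency_matrix_def intro!: sum.neutral)
    then have "phi n (largest_eigenvalue G) < (\<Sum>e\<leftarrow>es. exp e)"
      using sum_list_exp_gt_phi_Max[of es] len pos max assms(3) by (cases "es = []") auto
    also have "\<dots> = estrada_index G"
      unfolding estrada_index_def cp proots_prod_linear_factors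
      by (metis mset_map sum_mset_sum_list)
    finally show ?thesis by (simp add: phi_def algebra_simps)
  qed
  ultimately show ?thesis by blast
qed

end
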